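(* Let $E$ be a directed graph and let $H\subset E^0$ be a hereditary subset. (1) $H$ is maximal if and only if the quotient graph $E/H$ is simple. (2) If the graph $E$ is simple, then it is either an isolated vertex or a graph with no sources or sinks. Furthermore, it is strongly connected. If $E^0$ is finite, then $E$ is simple if and only if there is a closed path visiting all the vertices of the graph. (3) Let $A$ be an evolution algebra over a field $\mathbb{K}$ with associated graph $E$ (relative to a natural basis of $A$). If $H$ is a hereditary subset of $E^0$, then the evolution algebra $A/I_H$ has associated graph $E/H$ relative to a certain natural basis.
   Context: A directed graph $E=(E^0,E^1,r,s)$ consists of disjoint sets $E^0$ (vertices), $E^1$ (edges) of any cardinality and maps $r,s:E^1\to E^0$ (range, source). A path of length $m\ge1$ is a sequence of edges $f_1\cdots f_m$ with $r(f_i)=s(f_{i+1})$, with source $s(f_1)$ and range $r(f_m)$; vertices are trivial paths of length $0$. A closed path is a path whose source equals its range. A sink is a vertex $v$ with $s^{-1}(v)=\emptyset$; a source is a vertex $v$ with $r^{-1}(v)=\emptyset$. $E$ is strongly connected if for any two different vertices there is a path from the first to the second. A subset $H\subset E^0$ is hereditary if, for every $u\in H$, the range of every path with source $u$ belongs to $H$. A hereditary set $H\neq E^0$ is maximal if whenever $H\subset H'$ with $H'$ hereditary, then $H'=H$ or $H'=E^0$. $E$ is simple if it has no hereditary subsets other than $E^0$ and $\emptyset$. For $H$ hereditary, the quotient graph $E/H$ has vertex set $E^0\setminus H$, edge set $\{f\in E^1: s(f),r(f)\notin H\}$, and source and range maps restricted from $E$. An evolution algebra over a field $\mathbb{K}$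 is a (not necessarily associative or finite-dimensional) $\mathbb{K}$-algebra $A$ having a basis $B=\{e_i\}_{i\in\Lambda}$, called a natural basis, with $e_ie_j=0$ whenever $i\neq j$. Its associated directed graph relative to $B$ has vertex set $B$ and exactly one edge from $e_i$ to $e_j$ if the coefficient of $e_j$ in $e_i^2$ is nonzero, and no edge otherwise. For a hereditary $H\subset B$, $I_H:=\operatorname{span}(H)$ (an ideal of $A$), with $I_\emptyset=\{0\}$.
   Formalization: Part (1) is stated for H different from E^0 (for H = E^0 the quotient graph is empty, hence simple, but H is not maximal), and the closed-path criterion in (2) is stated for nonempty finite E^0 (the empty graph is simple but has no path). *)

theory Defs
  imports
    "Graph_Theory.Graph_Theory"
    "HOL-Algebra.QuotRing"
    "Jordan_Normal_Form.Missing_VectorSpace"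
begin

section \<open>Directed graphs\<close>

text \<open>
  A directed graph is a \<^locale>\<open>wf_digraph\<close>: loops, parallel arcs and infinite sets of vertices
  and arcs are allowed, and so is the graph without vertices. The source map is \<^const>\<open>tail\<close>, the
  range map is \<^const>\<open>head\<close>. A path from \<open>u\<close> to \<open>v\<close> is an arc list \<open>p\<close> with
  \<open>pre_digraph.awalk E u p v\<close>; the list is empty exactly for the trivial path at \<open>u = v\<close>.
\<close>

definition graph_sink :: "('v, 'e) pre_digraph \<Rightarrow> 'v \<Rightarrow> bool" where
  "graph_sink E v \<longleftrightarrow> v \<in> verts E \<and> {f \<in> arcs E. tail E f = v} = {}"

definition graph_source :: "('v, 'e) pre_digraph \<Rightarrow> 'v \<Rightarrow> bool" where
  "graph_source E v \<longleftrightarrow> v \<in> verts E \<and> {f \<in> arcs E. head E f = v} = {}"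

definition is_isolated_vertex :: "('v, 'e) pre_digraph \<Rightarrow> bool" where
  "is_isolated_vertex E \<longleftrightarrow> (\<exists>v. verts E = {v}) \<and> arcs E = {}"

text \<open>
  The library's \<^const>\<open>strongly_connected\<close> additionally demands that there be a vertex.
\<close>

definition strongly_connected_graph :: "('v, 'e) pre_digraph \<Rightarrow> bool" where
  "strongly_connected_graph E \<longleftrightarrow>
     (\<forall>u \<in> verts E. \<forall>v \<in> verts E. u \<noteq> v \<longrightarrow> (\<exists>p. pre_digraph.awalk E u p v))"

definition hereditary :: "('v, 'e) pre_digraph \<Rightarrow> 'v set \<Rightarrow> bool" where
  "hereditary E H \<longleftrightarrow>
     H \<subseteq> verts E \<and> (\<forall>u \<in> H. \<forall>p v. pre_digraph.awalk E u p v \<longrightarrow> v \<in> H)"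

definition maximal_hereditary :: "('v, 'e) pre_digraph \<Rightarrow> 'v set \<Rightarrow> bool" where
  "maximal_hereditary E H \<longleftrightarrow>
     hereditary E H \<and> H \<noteq> verts E \<and>
     (\<forall>H'. hereditary E H' \<and> H \<subseteq> H' \<longrightarrow> H' = H \<or> H' = verts E)"

text \<open>Under this definition the graph without vertices is simple.\<close>

definition simple_graph :: "('v, 'e) pre_digraph \<Rightarrow> bool" where
  "simple_graph E \<longleftrightarrow> (\<forall>H. hereditary E H \<longrightarrow> H = verts E \<or> H = {})"

definition quotient_graph :: "('v, 'e) pre_digraph \<Rightarrow> 'v set \<Rightarrow> ('v, 'e) pre_digraph" where
  "quotient_graph E H =
     \<lparr>verts = verts E - H, arcs = {f \<in> arcs E. tail E f \<notin> H \<and> head E f \<notin> H},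
      tail = tail E, head = head E\<rparr>"

section \<open>Evolution algebras\<close>

text \<open>
  An algebra is carried by a \<^typ>\<open>('k, 'a) module\<close> record, whose \<^const>\<open>mult\<close> is the
  product; it need not be associative, commutative or unital, and the field \<^const>\<open>one\<close> of the
  record is ignored.
\<close>

locale nonassoc_algebra = vectorspace K A for K and A +
  assumes mult_closed:
      "\<lbrakk>x \<in> carrier A; y \<in> carrier A\<rbrakk> \<Longrightarrow> x \<otimes>\<^bsub>A\<^esub> y \<in> carrier A"
    and mult_add_left:
      "\<lbrakk>x \<in> carrier A; y \<in> carrier A; z \<in> carrier A\<rbrakk> \<Longrightarrow>
       (x \<oplus>\<^bsub>A\<^esub> y) \<otimes>\<^bsub>A\<^esub> z = (x \<otimes>\<^bsub>A\<^esub> z) \<oplus>\<^bsub>A\<^esub> (y \<otimes>\<^bsub>A\<^esub> z)"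
    and mult_add_right:
      "\<lbrakk>x \<in> carrier A; y \<in> carrier A; z \<in> carrier A\<rbrakk> \<Longrightarrow>
       z \<otimes>\<^bsub>A\<^esub> (x \<oplus>\<^bsub>A\<^esub> y) = (z \<otimes>\<^bsub>A\<^esub> x) \<oplus>\<^bsub>A\<^esub> (z \<otimes>\<^bsub>A\<^esub> y)"
    and mult_smult_left:
      "\<lbrakk>k \<in> carrier K; x \<in> carrier A; y \<in> carrier A\<rbrakk> \<Longrightarrow>
       (k \<odot>\<^bsub>A\<^esub> x) \<otimes>\<^bsub>A\<^esub> y = k \<odot>\<^bsub>A\<^esub> (x \<otimes>\<^bsub>A\<^esub> y)"
    and mult_smult_right:
      "\<lbrakk>k \<in> carrier K; x \<in> carrier A; y \<in> carrier A\<rbrakk> \<Longrightarrow>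
       x \<otimes>\<^bsub>A\<^esub> (k \<odot>\<^bsub>A\<^esub> y) = k \<odot>\<^bsub>A\<^esub> (x \<otimes>\<^bsub>A\<^esub> y)"

text \<open>\<open>A\<close> is an evolution algebra over \<open>K\<close> with natural basis \<open>B\<close>.\<close>

locale natural_basis = nonassoc_algebra K A for K and A and B +
  assumes basis: "vectorspace.basis K A B"
    and orthogonal: "\<lbrakk>x \<in> B; y \<in> B; x \<noteq> y\<rbrakk> \<Longrightarrow> x \<otimes>\<^bsub>A\<^esub> y = \<zero>\<^bsub>A\<^esub>"

text \<open>
  The finitely supported coefficients of \<open>x\<close> with respect to \<open>B\<close>; they exist and are unique when
  \<open>B\<close> is a basis and \<open>x \<in> carrier A\<close>.
\<close>

definition basis_coeff ::
  "('k, 'n) ring_scheme \<Rightarrow> ('k, 'a, 'm) module_scheme \<Rightarrow> 'a set \<Rightarrow> 'a \<Rightarrow> 'a \<Rightarrow> 'k" where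
  "basis_coeff K A B x =
     (THE c. c \<in> B \<rightarrow> carrier K \<and> (\<forall>b. b \<notin> B \<longrightarrow> c b = \<zero>\<^bsub>K\<^esub>) \<and> finite {b. c b \<noteq> \<zero>\<^bsub>K\<^esub>} \<and>
             x = module.lincomb A c {b. c b \<noteq> \<zero>\<^bsub>K\<^esub>})"

definition associated_graph ::
  "('k, 'n) ring_scheme \<Rightarrow> ('k, 'a, 'm) module_scheme \<Rightarrow> 'a set \<Rightarrow> ('a, 'a \<times> 'a) pre_digraph" where
  "associated_graph K A B =
     \<lparr>verts = B,
      arcs = {(x, y). x \<in> B \<and> y \<in> B \<and> basis_coeff K A B (x \<otimes>\<^bsub>A\<^esub> x) y \<noteq> \<zero>\<^bsub>K\<^esub>},
      tail = fst, head = snd\<rparr>"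

text \<open>
  The algebra of cosets of an ideal \<open>I\<close>, extending \<^const>\<open>FactRing\<close> by the scalar action
  \<open>k (x + I) = k x + I\<close>; as for \<^const>\<open>rcoset_mult\<close>, all representatives are used at once.
\<close>

definition quotient_algebra ::
  "('k, 'a, 'm) module_scheme \<Rightarrow> 'a set \<Rightarrow> ('k, 'a set) module" where
  "quotient_algebra A I =
     \<lparr>carrier = a_rcosets\<^bsub>A\<^esub> I, mult = rcoset_mult A I, one = I +>\<^bsub>A\<^esub> \<one>\<^bsub>A\<^esub>,
      zero = I, add = set_add A, smult = (\<lambda>k X. \<Union>x \<in> X. I +>\<^bsub>A\<^esub> (k \<odot>\<^bsub>A\<^esub> x))\<rparr>"

end

theory Submission
  imports Defs
begin

text \<open>
  For the statements about graphs everything rests on one remark: a set of vertices is hereditary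
  as soon as it is closed under single arcs (\<open>hereditary_iff_arcs\<close>). Hence the hereditary sets of
  \<open>E/H\<close> are exactly the differences \<open>H' - H\<close> for hereditary \<open>H' \<supseteq> H\<close>, which makes maximality of \<open>H\<close>
  and simplicity of \<open>E/H\<close> the same condition for proper \<open>H\<close>. In a simple graph the hereditary set generated by a
  vertex, that is, everything reachable from it, must be the whole vertex set; this gives strong
  connectedness, and with finitely many vertices the connecting walks can be concatenated to a
  closed walk through all of them. A sink \<open>v\<close> makes \<open>{v}\<close> hereditary and a source \<open>v\<close> makes the
  complement of \<open>{v}\<close> hereditary, so in a simple graph either one must be the only vertex.

  For evolution algebras, a hereditary subset \<open>S\<close> of a natural basis \<open>B\<close> has the property that the
  squares of its members only involve basis vectors from \<open>S\<close>. As different basis vectors annihilate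
  each other, the span of \<open>S\<close> is therefore an ideal (\<open>span_ideal\<close>). The cosets of the vectors
  in \<open>B - S\<close> form a natural basis of the quotient, and passing to the quotient just deletes the
  coordinates in \<open>S\<close> (\<open>basis_coeff_coset\<close>). So the coefficients that decide about the arcs between
  vertices outside \<open>S\<close> do not change, and \<open>b \<mapsto> b + span S\<close> is an isomorphism of graphs.
\<close>

section \<open>Hereditary sets of vertices\<close>

lemma (in wf_digraph) awalk_stays_in_closed_set:
  assumes "\<forall>f \<in> arcs G. tail G f \<in> H \<longrightarrow> head G f \<in> H" and "awalk u p v" and "u \<in> H"
  shows "v \<in> H"
  using assms(2,3)
proof (induction p arbitrary: u)
  case Nil
  then show ?case by (simp add: awalk_Nil_iff)
next
  case (Cons f p)
  then show ?case using assms(1) by (auto simp: awalk_Cons_iff)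
qed

lemma (in wf_digraph) hereditary_iff_arcs:
  "hereditary G H \<longleftrightarrow> H \<subseteq> verts G \<and> (\<forall>f \<in> arcs G. tail G f \<in> H \<longrightarrow> head G f \<in> H)"
proof
  assume "hereditary G H"
  then show "H \<subseteq> verts G \<and> (\<forall>f \<in> arcs G. tail G f \<in> H \<longrightarrow> head G f \<in> H)"
    unfolding hereditary_def using arc_implies_awalk by blast
next
  assume "H \<subseteq> verts G \<and> (\<forall>f \<in> arcs G. tail G f \<in> H \<longrightarrow> head G f \<in> H)"
  then show "hereditary G H"
    unfolding hereditary_def using awalk_stays_in_closed_set by blast
qed

lemma (in wf_digraph) wf_digraph_quotient_graph: "wf_digraph (quotient_graph G H)"
  by unfold_locales (auto simp: quotient_graph_def)

text \<open>
  An arc of \<open>G\<close> that leaves \<open>W\<close> either ends in \<open>H\<close>, and then is deleted in the quotient, or survives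
  there. This is why closure of \<open>W\<close> in the quotient amounts to closure of \<open>H \<union> W\<close> in \<open>G\<close>.
\<close>

lemma (in wf_digraph) hereditary_quotient_graph_iff:
  assumes "hereditary G H"
  shows "hereditary (quotient_graph G H) W \<longleftrightarrow> W \<subseteq> verts G - H \<and> hereditary G (H \<union> W)"
proof -
  interpret Q: wf_digraph "quotient_graph G H" by (rule wf_digraph_quotient_graph)
  have "hereditary (quotient_graph G H) W \<longleftrightarrow>
      W \<subseteq> verts G - H \<and>
      (\<forall>f \<in> arcs G. tail G f \<notin> H \<and> head G f \<notin> H \<and> tail G f \<in> W \<longrightarrow> head G f \<in> W)"
    unfolding Q.hereditary_iff_arcs by (simp add: quotient_graph_def) blast
  also have "\<dots> \<longleftrightarrow> W \<subseteq> verts G - H \<and> hereditary G (H \<union> W)"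
    using assms unfolding hereditary_iff_arcs by blast
  finally show ?thesis .
qed

lemma (in wf_digraph) maximal_hereditary_iff_simple_quotient:
  assumes H: "hereditary G H" and proper: "H \<noteq> verts G"
  shows "maximal_hereditary G H \<longleftrightarrow> simple_graph (quotient_graph G H)"
proof
  assume max: "maximal_hereditary G H"
  show "simple_graph (quotient_graph G H)"
    unfolding simple_graph_def
  proof (intro allI impI)
    fix W assume "hereditary (quotient_graph G H) W"
    then have W: "W \<subseteq> verts G - H" "hereditary G (H \<union> W)"
      using hereditary_quotient_graph_iff[OF H] by auto
    then have "H \<union> W = H \<or> H \<union> W = verts G"
      using max unfolding maximal_hereditary_def by blast
    then show "W = verts (quotient_graph G H) \<or> W = {}"
      using W(1) by (auto simp: quotient_graph_def)
  qed
next
  assume simple: "simple_graph (quotient_graph G H)"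
  have "H' = H \<or> H' = verts G" if "hereditary G H'" "H \<subseteq> H'" for H'
  proof -
    have "H' \<subseteq> verts G" using that(1) by (simp add: hereditary_def)
    moreover have "H \<union> (H' - H) = H'" using that(2) by blast
    ultimately have "hereditary (quotient_graph G H) (H' - H)"
      using that(1) hereditary_quotient_graph_iff[OF H] by auto
    then have "H' - H = verts G - H \<or> H' - H = {}"
      using simple unfolding simple_graph_def by (auto simp: quotient_graph_def)
    then show ?thesis using that(2) \<open>H' \<subseteq> verts G\<close> H unfolding hereditary_def by blast
  qed
  then show "maximal_hereditary G H"
    using assms by (simp add: maximal_hereditary_def)
qed

section \<open>Simple graphs\<close>

text \<open>
  A vertex without outgoing arcs is hereditary by itself, and the complement of a vertex without
  incoming arcs is hereditary; simplicity leaves no room for a second vertex in either case, and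
  then no arc is possible since it would both start and end at the only vertex.
\<close>

lemma (in wf_digraph) simple_graph_isolated_or_no_source_sink:
  assumes simple: "simple_graph G"
  shows "is_isolated_vertex G \<or> (\<forall>v. \<not> graph_source G v \<and> \<not> graph_sink G v)"
proof -
  have "is_isolated_vertex G" if v: "v \<in> verts G" and
    ends: "{f \<in> arcs G. head G f = v} = {} \<or> {f \<in> arcs G. tail G f = v} = {}" for v
  proof -
    have "verts G = {v}"
    proof (cases "{f \<in> arcs G. tail G f = v} = {}")
      case True
      then have "hereditary G {v}" using v unfolding hereditary_iff_arcs by auto
      then show ?thesis using simple unfolding simple_graph_def by blast
    next
      case False
      then have "hereditary G (verts G - {v})" using ends unfolding hereditary_iff_arcs by auto
      then show ?thesis using simple v unfolding simple_graph_def by blast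
    qed
    then show ?thesis
      using ends tail_in_verts head_in_verts unfolding is_isolated_vertex_def by blast
  qed
  then show ?thesis unfolding graph_source_def graph_sink_def by blast
qed

lemma (in wf_digraph) simple_graph_imp_awalk:
  assumes "simple_graph G" "u \<in> verts G" "v \<in> verts G"
  shows "\<exists>p. awalk u p v"
proof -
  let ?R = "{w. \<exists>p. awalk u p w}"
  have "hereditary G ?R"
    unfolding hereditary_def using awalk_last_in_verts awalk_appendI by blast
  moreover have "u \<in> ?R" using assms(2) awalk_Nil_iff by blast
  ultimately have "?R = verts G" using assms(1) unfolding simple_graph_def by blast
  then show ?thesis using assms(3) by blast
qed

text \<open>
  Each further vertex \<open>v\<close> is visited by appending a detour from the base point \<open>u\<close> to \<open>v\<close> and back,
  so that the walk stays closed at \<open>u\<close>.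
\<close>

lemma (in wf_digraph) closed_awalk_through:
  assumes conn: "\<And>u v. u \<in> verts G \<Longrightarrow> v \<in> verts G \<Longrightarrow> \<exists>p. awalk u p v"
    and u: "u \<in> verts G" and fin: "finite V" and V: "V \<subseteq> verts G"
  shows "\<exists>p. awalk u p u \<and> V \<subseteq> set (awalk_verts u p)"
  using fin V
proof (induction V)
  case empty
  then show ?case using u awalk_Nil_iff by blast
next
  case (insert v V)
  then obtain p where p: "awalk u p u" "V \<subseteq> set (awalk_verts u p)" by auto
  obtain q where q: "awalk u q v" using conn[of u v] u insert.prems by auto
  obtain r where r: "awalk v r u" using conn[of v u] u insert.prems by auto
  have "v \<in> set (awalk_verts v r)" using r by (rule hd_in_awalk_verts)
  moreover have "awalk u (q @ r) u" using q r by (rule awalk_appendI)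
  moreover have "set (awalk_verts u (p @ q @ r)) =
      set (awalk_verts u p) \<union> (set (awalk_verts u q) \<union> set (awalk_verts v r))"
    using set_awalk_verts_append[OF p(1) calculation(2)] set_awalk_verts_append[OF q r] by simp
  ultimately have "insert v V \<subseteq> set (awalk_verts u (p @ q @ r))" using p(2) by blast
  moreover have "awalk u (p @ q @ r) u"
    using p(1) \<open>awalk u (q @ r) u\<close> by (rule awalk_appendI)
  ultimately show ?case by blast
qed

text \<open>
  Following the closed walk, one gets from any vertex to its base point and from there to any other
  vertex; a hereditary set with at least one element therefore contains all vertices.
\<close>

lemma (in wf_digraph) closed_covering_awalk_imp_simple:
  assumes p: "awalk u p u" and cover: "set (awalk_verts u p) = verts G"
  shows "simple_graph G"
  unfolding simple_graph_def
proof (intro allI impI)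
  fix H assume H: "hereditary G H"
  have "verts G \<subseteq> H" if "h \<in> H" for h
  proof
    fix v assume "v \<in> verts G"
    then obtain q where q: "awalk u q v" using cover awalk_decomp[OF p] by blast
    have "h \<in> set (awalk_verts u p)" using H that cover unfolding hereditary_def by blast
    then obtain r where "awalk h r u" using awalk_decomp[OF p] by blast
    then have "awalk h (r @ q) v" using q by (rule awalk_appendI)
    then show "v \<in> H" using H that unfolding hereditary_def by blast
  qed
  then show "H = verts G \<or> H = {}" using H unfolding hereditary_def by blast
qed

lemma (in wf_digraph) simple_graph_iff_closed_covering_awalk:
  assumes "finite (verts G)" and "verts G \<noteq> {}"
  shows "simple_graph G \<longleftrightarrow> (\<exists>u p. awalk u p u \<and> set (awalk_verts u p) = verts G)"
proof
  assume simple: "simple_graph G"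
  obtain u where u: "u \<in> verts G" using assms(2) by blast
  obtain p where p: "awalk u p u" "verts G \<subseteq> set (awalk_verts u p)"
    using closed_awalk_through[OF simple_graph_imp_awalk[OF simple] u assms(1)] by blast
  then have "set (awalk_verts u p) = verts G" by auto
  then show "\<exists>u p. awalk u p u \<and> set (awalk_verts u p) = verts G" using p(1) by blast
qed (use closed_covering_awalk_imp_simple in blast)

section \<open>Coordinates with respect to a basis\<close>

lemma (in module) lincomb_zero_coeffs:
  assumes "finite F" "F \<subseteq> carrier M" "a \<in> F \<rightarrow> carrier R" "G \<subseteq> F"
    and zero: "\<And>b. b \<in> F - G \<Longrightarrow> a b = \<zero>\<^bsub>R\<^esub>"
  shows "lincomb a F = lincomb a G"
proof -
  have "lincomb a F = lincomb a (G \<union> (F - G))"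
    using assms(4) by (simp add: Un_absorb1)
  also have "\<dots> = lincomb a G \<oplus>\<^bsub>M\<^esub> lincomb a (F - G)"
    using assms(1-4) by (intro lincomb_union) (auto simp: Un_absorb1)
  also have "lincomb a (F - G) = \<zero>\<^bsub>M\<^esub>"
    unfolding lincomb_def using assms(2) zero by (intro M.finsum_all0) (auto simp: subset_iff)
  also have "lincomb a G \<oplus>\<^bsub>M\<^esub> \<zero>\<^bsub>M\<^esub> = lincomb a G"
    using assms(2-4) by (intro M.r_zero lincomb_closed) auto
  finally show ?thesis .
qed

text \<open>
  This reads off \<^const>\<open>basis_coeff\<close> from any finite expansion, whether or not its
  coefficients are nonzero; the definite description is not unfolded again after this point.
\<close>

lemma (in vectorspace) basis_coeff_lincomb:
  assumes B: "basis B" and F: "finite F" "F \<subseteq> B" and a: "a \<in> F \<rightarrow> carrier K"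
  shows "basis_coeff K V B (lincomb a F) = (\<lambda>b. if b \<in> F then a b else \<zero>\<^bsub>K\<^esub>)"
proof -
  let ?c = "\<lambda>b. if b \<in> F then a b else \<zero>\<^bsub>K\<^esub>"
  have Bc: "B \<subseteq> carrier V" and indpt: "lin_indpt B" using B unfolding basis_def by auto
  have c: "?c b \<in> carrier K" for b using a by auto
  have ca: "lincomb ?c F = lincomb a F"
    using F Bc a by (intro lincomb_cong) auto
  have "lincomb ?c F = lincomb ?c {b. ?c b \<noteq> \<zero>\<^bsub>K\<^esub>}"
    using F Bc c by (intro lincomb_zero_coeffs) auto
  then have c_lincomb: "lincomb a F = lincomb ?c {b. ?c b \<noteq> \<zero>\<^bsub>K\<^esub>}" using ca by simp
  have c_fin: "finite {b. ?c b \<noteq> \<zero>\<^bsub>K\<^esub>}"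
    using F(1) by (rule finite_subset[rotated]) auto
  have unique: "d = ?c"
    if d: "d \<in> B \<rightarrow> carrier K" "\<forall>b. b \<notin> B \<longrightarrow> d b = \<zero>\<^bsub>K\<^esub>" and
      fin: "finite {b. d b \<noteq> \<zero>\<^bsub>K\<^esub>}" and
      eq: "lincomb a F = lincomb d {b. d b \<noteq> \<zero>\<^bsub>K\<^esub>}" for d
  proof (rule ccontr)
    \<comment> \<open>On the union of both index sets the difference of the coefficients is a relation in \<open>B\<close>.\<close>
    let ?G = "F \<union> {b. d b \<noteq> \<zero>\<^bsub>K\<^esub>}"
    have G: "finite ?G" "?G \<subseteq> B" using F fin d(2) by auto
    have Gc: "?G \<subseteq> carrier V" using G(2) Bc by blast
    have dG: "d \<in> ?G \<rightarrow> carrier K" using d(1) G(2) by auto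
    have "lincomb d ?G = lincomb a F"
      unfolding eq using G Gc dG by (intro lincomb_zero_coeffs) auto
    moreover have "lincomb ?c ?G = lincomb a F"
      unfolding ca[symmetric] using G(1) Gc c by (intro lincomb_zero_coeffs) auto
    moreover have "lincomb a F \<in> carrier V" using F(2) Bc a by (intro lincomb_closed) auto
    ultimately have diff_zero: "lincomb (\<lambda>b. d b \<ominus>\<^bsub>K\<^esub> ?c b) ?G = \<zero>\<^bsub>V\<^esub>"
      using lincomb_diff[OF G(1) Gc dG Pi_I[OF c]] by (simp add: M.minus_eq M.r_neg)
    have diff_closed: "(\<lambda>b. d b \<ominus>\<^bsub>K\<^esub> ?c b) \<in> ?G \<rightarrow> carrier K"
      using dG c by (intro Pi_I R.minus_closed) auto
    assume "d \<noteq> ?c"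
    then obtain b where b: "d b \<noteq> ?c b" by blast
    have bG: "b \<in> ?G" using b by (auto split: if_splits)
    have db: "d b \<in> carrier K" using dG bG by (rule Pi_mem)
    have nonzero: "d b \<ominus>\<^bsub>K\<^esub> ?c b \<noteq> \<zero>\<^bsub>K\<^esub>"
    proof
      assume "d b \<ominus>\<^bsub>K\<^esub> ?c b = \<zero>\<^bsub>K\<^esub>"
      then have "\<ominus>\<^bsub>K\<^esub> (\<ominus>\<^bsub>K\<^esub> ?c b) = d b"
        unfolding R.minus_eq by (intro R.minus_equality db R.a_inv_closed c)
      then show False using b R.minus_minus[OF c[of b]] by simp
    qed
    have "lin_dep B"
      by (rule lin_dep_crit[OF G diff_closed bG nonzero diff_zero])
    then show False using indpt by blast
  qed
  show ?thesis
    unfolding basis_coeff_def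
  proof (rule the_equality)
    show "?c \<in> B \<rightarrow> carrier K \<and> (\<forall>b. b \<notin> B \<longrightarrow> ?c b = \<zero>\<^bsub>K\<^esub>) \<and>
        finite {b. ?c b \<noteq> \<zero>\<^bsub>K\<^esub>} \<and> lincomb a F = lincomb ?c {b. ?c b \<noteq> \<zero>\<^bsub>K\<^esub>}"
      using c F(2) c_fin c_lincomb by auto
  qed (use unique in blast)
qed

lemma (in vectorspace) basis_expansion:
  assumes "basis B" "x \<in> carrier V"
  obtains F a where "finite F" "F \<subseteq> B" "a \<in> F \<rightarrow> carrier K" "x = lincomb a F"
proof -
  have "x \<in> span B" using assms unfolding basis_def by blast
  then show ?thesis unfolding span_def using that by blast
qed

lemma (in vectorspace) coeffs_of_span_element:
  assumes B: "basis B" and T: "T \<subseteq> B" and F: "finite F" "F \<subseteq> B - T"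
    and a: "a \<in> F \<rightarrow> carrier K" and mem: "lincomb a F \<in> span T" and b: "b \<in> F"
  shows "a b = \<zero>\<^bsub>K\<^esub>"
proof -
  obtain c G where G: "finite G" "G \<subseteq> T" "c \<in> G \<rightarrow> carrier K" "lincomb a F = lincomb c G"
    using mem unfolding span_def by blast
  have "(\<lambda>b. if b \<in> F then a b else \<zero>\<^bsub>K\<^esub>) = (\<lambda>b. if b \<in> G then c b else \<zero>\<^bsub>K\<^esub>)"
    using basis_coeff_lincomb[OF B F(1) _ a] basis_coeff_lincomb[OF B G(1) _ G(3)] F(2) G(2,4) T
    by (metis Diff_subset subset_trans)
  from fun_cong[OF this, of b] show ?thesis using b F(2) G(2) by (auto split: if_splits)
qed

lemma (in vectorspace) basis_mem_span_subset:
  assumes B: "basis B" and T: "T \<subseteq> B" and b: "b \<in> B" and mem: "b \<in> span T"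
  shows "b \<in> T"
proof (rule ccontr)
  assume "b \<notin> T"
  have "b \<in> carrier V" using B b unfolding basis_def by blast
  then have "lincomb (\<lambda>_. \<one>\<^bsub>K\<^esub>) {b} = b" unfolding lincomb_def by simp
  then have "\<one>\<^bsub>K\<^esub> = \<zero>\<^bsub>K\<^esub>"
    using coeffs_of_span_element[OF B T, of "{b}" "\<lambda>_. \<one>\<^bsub>K\<^esub>" b] b mem \<open>b \<notin> T\<close> by simp
  then show False using zero_not_one by simp
qed

section \<open>Quotients of algebras\<close>

text \<open>
  Closure under scalars is part of the notion: in an algebra without unit, an additive subgroup
  that absorbs products need not be a subspace.
\<close>

locale nonassoc_algebra_ideal = nonassoc_algebra K A for K and A and I +
  assumes ideal_subspace: "subspace K I A"
    and ideal_mult_left: "\<lbrakk>x \<in> carrier A; y \<in> I\<rbrakk> \<Longrightarrow> x \<otimes>\<^bsub>A\<^esub> y \<in> I"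
    and ideal_mult_right: "\<lbrakk>x \<in> I; y \<in> carrier A\<rbrakk> \<Longrightarrow> x \<otimes>\<^bsub>A\<^esub> y \<in> I"
begin

lemma ideal_smult: "\<lbrakk>k \<in> carrier K; x \<in> I\<rbrakk> \<Longrightarrow> k \<odot>\<^bsub>A\<^esub> x \<in> I"
  by (rule LinearCombinations.submodule.smult_closed[OF subspace.submod[OF ideal_subspace]])

lemma ideal_abelian_subgroup: "abelian_subgroup I A"
proof -
  note sub = subspace.submod[OF ideal_subspace]
  have I: "I \<subseteq> carrier A" by (rule LinearCombinations.submodule.subset[OF sub])
  have "subgroup I (add_monoid A)"
  proof (rule M.add.subgroupI)
    show "I \<subseteq> carrier A" by (rule I)
    show "I \<noteq> {}" using LinearCombinations.submodule.zero_closed[OF sub] by blast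
    show "\<ominus>\<^bsub>A\<^esub> x \<in> I" if "x \<in> I" for x
      using ideal_smult[of "\<ominus>\<^bsub>K\<^esub> \<one>\<^bsub>K\<^esub>" x] that I smult_minus_1[of x] by auto
    show "x \<oplus>\<^bsub>A\<^esub> y \<in> I" if "x \<in> I" "y \<in> I" for x y
      using that by (rule LinearCombinations.submodule.m_closed[OF sub])
  qed
  then show ?thesis
    by (intro abelian_subgroupI3 additive_subgroupI M.abelian_group_axioms)
qed

sublocale ideal: abelian_subgroup I A
  by (rule ideal_abelian_subgroup)

lemma coset_eqI: "\<lbrakk>h \<in> I; x \<in> carrier A\<rbrakk> \<Longrightarrow> I +>\<^bsub>A\<^esub> (h \<oplus>\<^bsub>A\<^esub> x) = I +>\<^bsub>A\<^esub> x"
  using ideal.a_repr_independence'[of "h \<oplus>\<^bsub>A\<^esub> x" x] M.a_rcosI[OF _ ideal.a_subset] by simp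

lemma coset_memE:
  assumes "y \<in> I +>\<^bsub>A\<^esub> x"
  obtains h where "h \<in> I" "y = h \<oplus>\<^bsub>A\<^esub> x"
  using assms by (auto simp: a_r_coset_def')

text \<open>
  \<^const>\<open>rcoset_mult\<close> is a union over all representatives. For \<open>h, k \<in> I\<close> the products
  \<open>(h + x) (k + y)\<close> and \<open>x y\<close> differ by \<open>h (k + y) + x k \<in> I\<close>, so all members of that union are the
  same coset.
\<close>

lemma coset_mult:
  assumes x: "x \<in> carrier A" and y: "y \<in> carrier A"
  shows "rcoset_mult A I (I +>\<^bsub>A\<^esub> x) (I +>\<^bsub>A\<^esub> y) = I +>\<^bsub>A\<^esub> (x \<otimes>\<^bsub>A\<^esub> y)"
proof -
  have rep: "I +>\<^bsub>A\<^esub> (x' \<otimes>\<^bsub>A\<^esub> y') = I +>\<^bsub>A\<^esub> (x \<otimes>\<^bsub>A\<^esub> y)"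
    if x': "x' \<in> I +>\<^bsub>A\<^esub> x" and y': "y' \<in> I +>\<^bsub>A\<^esub> y" for x' y'
  proof -
    obtain h where h: "h \<in> I" "x' = h \<oplus>\<^bsub>A\<^esub> x" using x' by (rule coset_memE)
    obtain k where k: "k \<in> I" "y' = k \<oplus>\<^bsub>A\<^esub> y" using y' by (rule coset_memE)
    have hc: "h \<in> carrier A" and kc: "k \<in> carrier A" using h k by auto
    have y'c: "y' \<in> carrier A" using k(2) kc y by simp
    have "x' \<otimes>\<^bsub>A\<^esub> y' = h \<otimes>\<^bsub>A\<^esub> y' \<oplus>\<^bsub>A\<^esub> (x \<otimes>\<^bsub>A\<^esub> k \<oplus>\<^bsub>A\<^esub> x \<otimes>\<^bsub>A\<^esub> y)"
      using mult_add_left[OF hc x y'c] mult_add_right[OF kc y x] h(2) k(2) by simp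
    then have "I +>\<^bsub>A\<^esub> (x' \<otimes>\<^bsub>A\<^esub> y') = I +>\<^bsub>A\<^esub> (x \<otimes>\<^bsub>A\<^esub> k \<oplus>\<^bsub>A\<^esub> x \<otimes>\<^bsub>A\<^esub> y)"
      using h(1) x y y'c kc by (simp add: coset_eqI ideal_mult_right mult_closed)
    also have "\<dots> = I +>\<^bsub>A\<^esub> (x \<otimes>\<^bsub>A\<^esub> y)"
      using k(1) x y by (simp add: coset_eqI ideal_mult_left mult_closed)
    finally show ?thesis .
  qed
  show ?thesis
    unfolding rcoset_mult_def using rep ideal.a_rcos_self[OF x] ideal.a_rcos_self[OF y] by blast
qed

lemma coset_smult:
  assumes k: "k \<in> carrier K" and x: "x \<in> carrier A"
  shows "(\<Union>x' \<in> I +>\<^bsub>A\<^esub> x. I +>\<^bsub>A\<^esub> (k \<odot>\<^bsub>A\<^esub> x')) = I +>\<^bsub>A\<^esub> (k \<odot>\<^bsub>A\<^esub> x)"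
proof -
  have rep: "I +>\<^bsub>A\<^esub> (k \<odot>\<^bsub>A\<^esub> x') = I +>\<^bsub>A\<^esub> (k \<odot>\<^bsub>A\<^esub> x)" if x': "x' \<in> I +>\<^bsub>A\<^esub> x" for x'
  proof -
    obtain h where h: "h \<in> I" "x' = h \<oplus>\<^bsub>A\<^esub> x" using x' by (rule coset_memE)
    then show ?thesis
      using k x by (simp add: smult_r_distr coset_eqI ideal_smult)
  qed
  then show ?thesis using ideal.a_rcos_self[OF x] by blast
qed

lemma quotient_carrier: "carrier (quotient_algebra A I) = (\<lambda>x. I +>\<^bsub>A\<^esub> x) ` carrier A"
  by (auto simp: quotient_algebra_def A_RCOSETS_def')

lemma quotient_zero: "\<zero>\<^bsub>quotient_algebra A I\<^esub> = I"
  by (simp add: quotient_algebra_def)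

lemma quotient_add:
  "\<lbrakk>x \<in> carrier A; y \<in> carrier A\<rbrakk> \<Longrightarrow>
   (I +>\<^bsub>A\<^esub> x) \<oplus>\<^bsub>quotient_algebra A I\<^esub> (I +>\<^bsub>A\<^esub> y) = I +>\<^bsub>A\<^esub> (x \<oplus>\<^bsub>A\<^esub> y)"
  by (simp add: quotient_algebra_def ideal.a_rcos_sum)

lemma quotient_mult:
  "\<lbrakk>x \<in> carrier A; y \<in> carrier A\<rbrakk> \<Longrightarrow>
   (I +>\<^bsub>A\<^esub> x) \<otimes>\<^bsub>quotient_algebra A I\<^esub> (I +>\<^bsub>A\<^esub> y) = I +>\<^bsub>A\<^esub> (x \<otimes>\<^bsub>A\<^esub> y)"
  by (simp add: quotient_algebra_def coset_mult)

lemma quotient_smult: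
  "\<lbrakk>k \<in> carrier K; x \<in> carrier A\<rbrakk> \<Longrightarrow>
   k \<odot>\<^bsub>quotient_algebra A I\<^esub> (I +>\<^bsub>A\<^esub> x) = I +>\<^bsub>A\<^esub> (k \<odot>\<^bsub>A\<^esub> x)"
  by (simp add: quotient_algebra_def coset_smult)

lemma quotient_abelian_group: "abelian_group (quotient_algebra A I)"
proof (rule abelian_groupI)
  have I: "\<zero>\<^bsub>quotient_algebra A I\<^esub> = I +>\<^bsub>A\<^esub> \<zero>\<^bsub>A\<^esub>"
    using ideal.a_subset by (simp add: quotient_zero)
  then show "\<zero>\<^bsub>quotient_algebra A I\<^esub> \<in> carrier (quotient_algebra A I)"
    by (simp add: quotient_carrier)
  fix X assume X: "X \<in> carrier (quotient_algebra A I)"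
  then show "\<zero>\<^bsub>quotient_algebra A I\<^esub> \<oplus>\<^bsub>quotient_algebra A I\<^esub> X = X"
    unfolding I by (auto simp: quotient_carrier quotient_add)
  obtain x where x: "x \<in> carrier A" "X = I +>\<^bsub>A\<^esub> x" using X by (auto simp: quotient_carrier)
  then have "(I +>\<^bsub>A\<^esub> (\<ominus>\<^bsub>A\<^esub> x)) \<oplus>\<^bsub>quotient_algebra A I\<^esub> X = \<zero>\<^bsub>quotient_algebra A I\<^esub>"
    unfolding I by (simp add: quotient_add M.l_neg)
  then show "\<exists>Y \<in> carrier (quotient_algebra A I).
      Y \<oplus>\<^bsub>quotient_algebra A I\<^esub> X = \<zero>\<^bsub>quotient_algebra A I\<^esub>"
    using x(1) by (auto simp: quotient_carrier)
qed (auto simp: quotient_carrier quotient_add M.a_ac)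

lemma quotient_module: "module K (quotient_algebra A I)"
proof (rule moduleI)
  show "cring K" by (rule R.cring_axioms)
  show "abelian_group (quotient_algebra A I)" by (rule quotient_abelian_group)
qed (auto simp: quotient_carrier quotient_add quotient_smult smult_l_distr smult_r_distr
    smult_assoc1)

lemma quotient_nonassoc_algebra: "nonassoc_algebra K (quotient_algebra A I)"
proof -
  have "vectorspace K (quotient_algebra A I)"
    by (intro vectorspace.intro quotient_module field_axioms)
  then show ?thesis
    by (rule nonassoc_algebra.intro, unfold_locales)
      (auto simp: quotient_carrier quotient_add quotient_smult quotient_mult mult_closed
        mult_add_left mult_add_right mult_smult_left mult_smult_right)
qed

sublocale quotient: nonassoc_algebra K "quotient_algebra A I"
  by (rule quotient_nonassoc_algebra)

lemma coset_mod_hom: "mod_hom K A (quotient_algebra A I) (\<lambda>x. I +>\<^bsub>A\<^esub> x)"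
  by unfold_locales
    (auto simp: module_hom_def quotient_carrier quotient_add quotient_smult)

text \<open>
  The index set of a linear combination is the set of its vectors, so moving it along the coset map
  reindexes the sum; injectivity excludes that vectors merge into one coset and lose summands.
\<close>

lemma coset_lincomb:
  assumes F: "F \<subseteq> carrier A" and inj: "inj_on (\<lambda>x. I +>\<^bsub>A\<^esub> x) F"
    and a: "a \<in> (\<lambda>x. I +>\<^bsub>A\<^esub> x) ` F \<rightarrow> carrier K"
  shows "quotient.lincomb a ((\<lambda>x. I +>\<^bsub>A\<^esub> x) ` F) = I +>\<^bsub>A\<^esub> lincomb (\<lambda>x. a (I +>\<^bsub>A\<^esub> x)) F"
proof -
  interpret coset: mod_hom K A "quotient_algebra A I" "\<lambda>x. I +>\<^bsub>A\<^esub> x" by (rule coset_mod_hom)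
  have term_closed: "a (I +>\<^bsub>A\<^esub> x) \<odot>\<^bsub>A\<^esub> x \<in> carrier A" if "x \<in> F" for x
    using that F a by (intro smult_closed) auto
  have "quotient.lincomb a ((\<lambda>x. I +>\<^bsub>A\<^esub> x) ` F) =
      (\<Oplus>\<^bsub>quotient_algebra A I\<^esub> x \<in> F. a (I +>\<^bsub>A\<^esub> x) \<odot>\<^bsub>quotient_algebra A I\<^esub> (I +>\<^bsub>A\<^esub> x))"
    unfolding quotient.lincomb_def using F inj a
    by (intro quotient.M.finsum_reindex) (auto simp: Pi_iff)
  also have "\<dots> = (\<Oplus>\<^bsub>quotient_algebra A I\<^esub> x \<in> F. I +>\<^bsub>A\<^esub> (a (I +>\<^bsub>A\<^esub> x) \<odot>\<^bsub>A\<^esub> x))"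
  proof (rule quotient.M.finsum_cong'[OF refl])
    show "(\<lambda>x. I +>\<^bsub>A\<^esub> (a (I +>\<^bsub>A\<^esub> x) \<odot>\<^bsub>A\<^esub> x)) \<in> F \<rightarrow> carrier (quotient_algebra A I)"
      using term_closed by (intro Pi_I coset.f_im)
    show "a (I +>\<^bsub>A\<^esub> x) \<odot>\<^bsub>quotient_algebra A I\<^esub> (I +>\<^bsub>A\<^esub> x) =
        I +>\<^bsub>A\<^esub> (a (I +>\<^bsub>A\<^esub> x) \<odot>\<^bsub>A\<^esub> x)" if "x \<in> F" for x
      using that F a by (intro quotient_smult) auto
  qed
  also have "\<dots> = I +>\<^bsub>A\<^esub> lincomb (\<lambda>x. a (I +>\<^bsub>A\<^esub> x)) F"
    unfolding lincomb_def using F term_closed by (intro coset.hom_sum[symmetric] Pi_I) auto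
  finally show ?thesis .
qed

end

section \<open>Quotients of evolution algebras\<close>

text \<open>
  By this lemma and its mirror image, to have products in a subspace it suffices to check products
  of spanning vectors.
\<close>

lemma (in nonassoc_algebra) left_multiplier_submodule:
  assumes W: "LinearCombinations.submodule K W A" and x: "x \<in> carrier A"
  shows "LinearCombinations.submodule K {y \<in> carrier A. x \<otimes>\<^bsub>A\<^esub> y \<in> W} A"
proof (rule LinearCombinations.submodule.intro)
  have "x \<otimes>\<^bsub>A\<^esub> \<zero>\<^bsub>A\<^esub> = \<zero>\<^bsub>A\<^esub>"
    using mult_smult_right[OF R.zero_closed x M.zero_closed] x by (simp add: mult_closed)
  then show "\<zero>\<^bsub>A\<^esub> \<in> {y \<in> carrier A. x \<otimes>\<^bsub>A\<^esub> y \<in> W}"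
    using LinearCombinations.submodule.zero_closed[OF W] by simp
  show "u \<oplus>\<^bsub>A\<^esub> w \<in> {y \<in> carrier A. x \<otimes>\<^bsub>A\<^esub> y \<in> W}"
    if "u \<in> {y \<in> carrier A. x \<otimes>\<^bsub>A\<^esub> y \<in> W}" "w \<in> {y \<in> carrier A. x \<otimes>\<^bsub>A\<^esub> y \<in> W}" for u w
    using that x LinearCombinations.submodule.m_closed[OF W, of "x \<otimes>\<^bsub>A\<^esub> u" "x \<otimes>\<^bsub>A\<^esub> w"]
    by (simp add: mult_add_right)
  show "k \<odot>\<^bsub>A\<^esub> u \<in> {y \<in> carrier A. x \<otimes>\<^bsub>A\<^esub> y \<in> W}"
    if "k \<in> carrier K" "u \<in> {y \<in> carrier A. x \<otimes>\<^bsub>A\<^esub> y \<in> W}" for k u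
    using that x LinearCombinations.submodule.smult_closed[OF W, of k "x \<otimes>\<^bsub>A\<^esub> u"]
    by (simp add: mult_smult_right)
qed (use module_axioms in auto)

lemma (in nonassoc_algebra) right_multiplier_submodule:
  assumes W: "LinearCombinations.submodule K W A" and y: "y \<in> carrier A"
  shows "LinearCombinations.submodule K {x \<in> carrier A. x \<otimes>\<^bsub>A\<^esub> y \<in> W} A"
proof (rule LinearCombinations.submodule.intro)
  have "\<zero>\<^bsub>A\<^esub> \<otimes>\<^bsub>A\<^esub> y = \<zero>\<^bsub>A\<^esub>"
    using mult_smult_left[OF R.zero_closed M.zero_closed y] y by (simp add: mult_closed)
  then show "\<zero>\<^bsub>A\<^esub> \<in> {x \<in> carrier A. x \<otimes>\<^bsub>A\<^esub> y \<in> W}"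
    using LinearCombinations.submodule.zero_closed[OF W] by simp
  show "u \<oplus>\<^bsub>A\<^esub> w \<in> {x \<in> carrier A. x \<otimes>\<^bsub>A\<^esub> y \<in> W}"
    if "u \<in> {x \<in> carrier A. x \<otimes>\<^bsub>A\<^esub> y \<in> W}" "w \<in> {x \<in> carrier A. x \<otimes>\<^bsub>A\<^esub> y \<in> W}" for u w
    using that y LinearCombinations.submodule.m_closed[OF W, of "u \<otimes>\<^bsub>A\<^esub> y" "w \<otimes>\<^bsub>A\<^esub> y"]
    by (simp add: mult_add_left)
  show "k \<odot>\<^bsub>A\<^esub> u \<in> {x \<in> carrier A. x \<otimes>\<^bsub>A\<^esub> y \<in> W}"
    if "k \<in> carrier K" "u \<in> {x \<in> carrier A. x \<otimes>\<^bsub>A\<^esub> y \<in> W}" for k u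
    using that y LinearCombinations.submodule.smult_closed[OF W, of k "u \<otimes>\<^bsub>A\<^esub> y"]
    by (simp add: mult_smult_left)
qed (use module_axioms in auto)

context natural_basis
begin

lemma basis_carrier: "B \<subseteq> carrier A"
  using basis unfolding basis_def by blast

lemma basis_span: "span B = carrier A"
  using basis unfolding basis_def by blast

lemma hereditary_square_in_span:
  assumes S: "hereditary (associated_graph K A B) S" and x: "x \<in> S"
  shows "x \<otimes>\<^bsub>A\<^esub> x \<in> span S"
proof -
  interpret G: wf_digraph "associated_graph K A B"
    by unfold_locales (auto simp: associated_graph_def)
  have SB: "S \<subseteq> B" using S unfolding hereditary_def by (simp add: associated_graph_def)
  have arcs: "y \<in> S" if "y \<in> B" "basis_coeff K A B (x \<otimes>\<^bsub>A\<^esub> x) y \<noteq> \<zero>\<^bsub>K\<^esub>" for y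
    using S x that SB unfolding G.hereditary_iff_arcs by (auto simp: associated_graph_def)
  have "x \<otimes>\<^bsub>A\<^esub> x \<in> carrier A" using x SB basis_carrier by (intro mult_closed) auto
  then obtain F a where F: "finite F" "F \<subseteq> B" "a \<in> F \<rightarrow> carrier K" "x \<otimes>\<^bsub>A\<^esub> x = lincomb a F"
    using basis_expansion[OF basis] by blast
  have "a b = \<zero>\<^bsub>K\<^esub>" if "b \<in> F - (F \<inter> S)" for b
    using arcs[of b] that F(2) unfolding F(4) basis_coeff_lincomb[OF basis F(1-3)] by auto
  then have "lincomb a F = lincomb a (F \<inter> S)"
    using F basis_carrier by (intro lincomb_zero_coeffs) auto
  moreover have "lincomb a (F \<inter> S) \<in> span S"
    unfolding span_def using F(1,3) by blast
  ultimately show ?thesis using F(4) by simp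
qed

text \<open>
  A product of a basis vector \<open>b\<close> with some \<open>s \<in> S\<close> is zero or the square of \<open>s\<close>. Bilinearity extends
  this from \<open>B\<close> to the whole algebra in the one factor, and from \<open>S\<close> to its span in the other.
\<close>

lemma span_ideal:
  assumes S: "S \<subseteq> B" and squares: "\<And>x. x \<in> S \<Longrightarrow> x \<otimes>\<^bsub>A\<^esub> x \<in> span S"
  shows "nonassoc_algebra_ideal K A (span S)"
proof (intro nonassoc_algebra_ideal.intro nonassoc_algebra_ideal_axioms.intro
    nonassoc_algebra_axioms)
  have Sc: "S \<subseteq> carrier A" using S basis_carrier by blast
  show "subspace K (span S) A" using Sc by (rule span_is_subspace)
  have W: "LinearCombinations.submodule K (span S) A" using Sc by (rule span_is_submodule)
  have basis_products: "b \<otimes>\<^bsub>A\<^esub> s \<in> span S \<and> s \<otimes>\<^bsub>A\<^esub> b \<in> span S" if "b \<in> B" "s \<in> S" for b s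
    using that S squares orthogonal[of b s] orthogonal[of s b]
      LinearCombinations.submodule.zero_closed[OF W] by (cases "b = s") auto
  have left: "x \<otimes>\<^bsub>A\<^esub> s \<in> span S" if "x \<in> carrier A" "s \<in> S" for x s
  proof -
    have "span B \<subseteq> {x \<in> carrier A. x \<otimes>\<^bsub>A\<^esub> s \<in> span S}"
      using that Sc basis_carrier basis_products
      by (intro span_is_subset right_multiplier_submodule W) auto
    then show ?thesis using that(1) basis_span by blast
  qed
  have right: "s \<otimes>\<^bsub>A\<^esub> x \<in> span S" if "x \<in> carrier A" "s \<in> S" for x s
  proof -
    have "span B \<subseteq> {x \<in> carrier A. s \<otimes>\<^bsub>A\<^esub> x \<in> span S}"
      using that Sc basis_carrier basis_products
      by (intro span_is_subset left_multiplier_submodule W) auto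
    then show ?thesis using that(1) basis_span by blast
  qed
  show "x \<otimes>\<^bsub>A\<^esub> y \<in> span S" if "x \<in> carrier A" "y \<in> span S" for x y
  proof -
    have "span S \<subseteq> {y \<in> carrier A. x \<otimes>\<^bsub>A\<^esub> y \<in> span S}"
      using that(1) Sc left by (intro span_is_subset left_multiplier_submodule W) auto
    then show ?thesis using that(2) by blast
  qed
  show "x \<otimes>\<^bsub>A\<^esub> y \<in> span S" if "x \<in> span S" "y \<in> carrier A" for x y
  proof -
    have "span S \<subseteq> {x \<in> carrier A. x \<otimes>\<^bsub>A\<^esub> y \<in> span S}"
      using that(2) Sc right by (intro span_is_subset right_multiplier_submodule W) auto
    then show ?thesis using that(1) by blast
  qed
qed

end

locale hereditary_quotient = natural_basis K A B for K and A and B +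
  fixes S
  assumes hereditary_S: "hereditary (associated_graph K A B) S"
begin

lemma S_subset: "S \<subseteq> B"
  using hereditary_S unfolding hereditary_def by (simp add: associated_graph_def)

sublocale nonassoc_algebra_ideal K A "span S"
  by (rule span_ideal[OF S_subset hereditary_square_in_span[OF hereditary_S]])

abbreviation coset :: "'c \<Rightarrow> 'c set" where
  "coset x \<equiv> span S +>\<^bsub>A\<^esub> x"

abbreviation Q where
  "Q \<equiv> quotient_algebra A (span S)"

text \<open>
  If \<open>b\<close> and \<open>c\<close> have the same coset, then \<open>b\<close> lies in the span of \<open>S \<union> {c}\<close>, and a basis vector only
  lies in the span of those sets of basis vectors to which it belongs.
\<close>

lemma inj_on_coset: "inj_on coset (B - S)"
proof (rule inj_onI)
  fix b c assume b: "b \<in> B - S" and c: "c \<in> B - S" and eq: "coset b = coset c"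
  have "b \<in> coset c" using b basis_carrier ideal.a_rcos_self[of b] eq by auto
  then obtain h where h: "h \<in> span S" "b = h \<oplus>\<^bsub>A\<^esub> c" by (rule coset_memE)
  let ?T = "insert c S"
  have T: "?T \<subseteq> B" "?T \<subseteq> carrier A" using c S_subset basis_carrier by auto
  have "h \<in> span ?T" using h(1) span_is_monotone[of S ?T] by blast
  moreover have "c \<in> span ?T" using in_own_span[OF T(2)] by blast
  ultimately have "b \<in> span ?T"
    unfolding h(2) by (rule LinearCombinations.submodule.m_closed[OF span_is_submodule[OF T(2)]])
  then have "b \<in> ?T" using basis_mem_span_subset[OF basis T(1)] b by blast
  then show "b = c" using b by blast
qed

text \<open>
  A relation among the cosets says that a combination of vectors from \<open>B - S\<close> lies in the span of \<open>S\<close>,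
  which by uniqueness of coordinates happens only for zero coefficients.
\<close>

lemma lin_indpt_cosets: "quotient.lin_indpt (coset ` (B - S))"
proof
  assume "quotient.lin_dep (coset ` (B - S))"
  then obtain F' a v where F': "finite F'" "F' \<subseteq> coset ` (B - S)" "a \<in> F' \<rightarrow> carrier K"
      "quotient.lincomb a F' = \<zero>\<^bsub>Q\<^esub>" "v \<in> F'" "a v \<noteq> \<zero>\<^bsub>K\<^esub>"
    unfolding quotient.lin_dep_def by blast
  obtain F where F: "F \<subseteq> B - S" "finite F" "F' = coset ` F"
    using finite_subset_image[OF F'(1,2)] by blast
  have inj: "inj_on coset F" using inj_on_coset F(1) by (rule inj_on_subset)
  have Fc: "F \<subseteq> carrier A" using F(1) basis_carrier by blast
  have a: "(\<lambda>x. a (coset x)) \<in> F \<rightarrow> carrier K" using F'(3) F(3) by auto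
  have "coset (lincomb (\<lambda>x. a (coset x)) F) = span S"
    using coset_lincomb[OF Fc inj, of a] F'(3,4) F(3) by (simp add: quotient_zero)
  moreover have "lincomb (\<lambda>x. a (coset x)) F \<in> carrier A" using Fc a by (rule lincomb_closed)
  ultimately have "lincomb (\<lambda>x. a (coset x)) F \<in> span S" using ideal.a_rcos_self by blast
  then have "a (coset b) = \<zero>\<^bsub>K\<^esub>" if "b \<in> F" for b
    using coeffs_of_span_element[OF basis S_subset F(2,1) a _ that] by blast
  then show False using F'(5,6) F(3) by blast
qed

text \<open>
  The coset of \<open>x\<close> is represented by the part of the expansion of \<open>x\<close> outside \<open>S\<close>. This single
  expansion shows both that the cosets span the quotient and what the coordinates of \<open>coset x\<close> are.
\<close>

lemma coset_expansion:
  assumes x: "x \<in> carrier A"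
  obtains F g where "finite F" "F \<subseteq> B - S" "g \<in> coset ` F \<rightarrow> carrier K"
    "coset x = quotient.lincomb g (coset ` F)"
    "\<And>b. b \<in> B - S \<Longrightarrow> basis_coeff K A B x b = (if b \<in> F then g (coset b) else \<zero>\<^bsub>K\<^esub>)"
proof -
  obtain F a where F: "finite F" "F \<subseteq> B" "a \<in> F \<rightarrow> carrier K" "x = lincomb a F"
    using basis_expansion[OF basis x] by blast
  have Fc: "F \<subseteq> carrier A" using F(2) basis_carrier by blast
  \<comment> \<open>Coefficients in the quotient are indexed by cosets, so \<open>a\<close> is carried over along the inverse of
    the coset map on \<open>B - S\<close>.\<close>
  define g where "g = (\<lambda>X. a (the_inv_into (B - S) coset X))"
  have g: "g (coset b) = a b" if "b \<in> B - S" for b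
    using the_inv_into_f_f[OF inj_on_coset that] by (simp add: g_def)
  have gF: "g (coset b) = a b" if "b \<in> F - S" for b using that F(2) by (intro g) blast
  have gFK: "g (coset b) \<in> carrier K" if "b \<in> F - S" for b
    unfolding gF[OF that] using that F(3) by blast
  have gK: "g \<in> coset ` (F - S) \<rightarrow> carrier K" using gFK by blast
  have inj: "inj_on coset (F - S)" using F(2) by (intro inj_on_subset[OF inj_on_coset]) blast
  have "x = lincomb a ((F \<inter> S) \<union> (F - S))" using F(4) by (simp add: Un_Diff_Int Un_commute)
  also have "\<dots> = lincomb a (F \<inter> S) \<oplus>\<^bsub>A\<^esub> lincomb a (F - S)"
    using F(1,3) Fc by (intro lincomb_union) auto
  finally have "coset x = coset (lincomb a (F \<inter> S) \<oplus>\<^bsub>A\<^esub> lincomb a (F - S))" by simp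
  also have "\<dots> = coset (lincomb a (F - S))"
  proof (rule coset_eqI)
    show "lincomb a (F \<inter> S) \<in> span S" unfolding span_def using F(1,3) by blast
    show "lincomb a (F - S) \<in> carrier A" using F(3) Fc by (intro lincomb_closed) auto
  qed
  also have "lincomb a (F - S) = lincomb (\<lambda>b. g (coset b)) (F - S)"
    using Fc F(3) by (intro lincomb_cong) (auto simp: gF)
  also have "coset \<dots> = quotient.lincomb g (coset ` (F - S))"
    using Fc by (intro coset_lincomb[symmetric] inj gK) blast
  finally have x_coset: "coset x = quotient.lincomb g (coset ` (F - S))" .
  have "basis_coeff K A B x b = (if b \<in> F - S then g (coset b) else \<zero>\<^bsub>K\<^esub>)"
    if "b \<in> B - S" for b
    unfolding F(4) basis_coeff_lincomb[OF basis F(1-3)] using that by (simp add: gF)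
  moreover have "finite (F - S)" "F - S \<subseteq> B - S" using F(1,2) by auto
  ultimately show thesis using that[OF _ _ gK x_coset] by blast
qed

lemma basis_cosets: "quotient.basis (coset ` (B - S))"
proof -
  have sub: "coset ` (B - S) \<subseteq> carrier Q" using basis_carrier by (auto simp: quotient_carrier)
  have "carrier Q \<subseteq> quotient.span (coset ` (B - S))"
  proof
    fix X assume "X \<in> carrier Q"
    then obtain x where x: "x \<in> carrier A" "X = coset x" by (auto simp: quotient_carrier)
    obtain F g where "finite F" "F \<subseteq> B - S" "g \<in> coset ` F \<rightarrow> carrier K"
        "coset x = quotient.lincomb g (coset ` F)"
      using coset_expansion[OF x(1)] by metis
    then show "X \<in> quotient.span (coset ` (B - S))"
      unfolding quotient.span_def x(2) by blast
  qed
  then show ?thesis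
    using sub lin_indpt_cosets quotient.span_is_subset2[OF sub] unfolding quotient.basis_def by blast
qed

lemma basis_coeff_coset:
  assumes x: "x \<in> carrier A" and b: "b \<in> B - S"
  shows "basis_coeff K Q (coset ` (B - S)) (coset x) (coset b) = basis_coeff K A B x b"
proof -
  obtain F g where F: "finite F" "F \<subseteq> B - S" "g \<in> coset ` F \<rightarrow> carrier K"
      "coset x = quotient.lincomb g (coset ` F)"
    and coeff: "\<And>b. b \<in> B - S \<Longrightarrow> basis_coeff K A B x b = (if b \<in> F then g (coset b) else \<zero>\<^bsub>K\<^esub>)"
    using coset_expansion[OF x] by metis
  have "basis_coeff K Q (coset ` (B - S)) (coset x) (coset b) =
      (if coset b \<in> coset ` F then g (coset b) else \<zero>\<^bsub>K\<^esub>)"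
    unfolding F(4) using F by (subst quotient.basis_coeff_lincomb[OF basis_cosets]) auto
  also have "coset b \<in> coset ` F \<longleftrightarrow> b \<in> F"
    using inj_on_image_mem_iff[OF inj_on_coset b F(2)] .
  finally show ?thesis using coeff[OF b] by simp
qed

lemma natural_basis_cosets: "natural_basis K Q (coset ` (B - S))"
proof (intro natural_basis.intro natural_basis_axioms.intro quotient_nonassoc_algebra basis_cosets)
  fix X Y assume "X \<in> coset ` (B - S)" "Y \<in> coset ` (B - S)" "X \<noteq> Y"
  then obtain x y where xy: "x \<in> B" "y \<in> B" "x \<noteq> y" "X = coset x" "Y = coset y" by blast
  then have "X \<otimes>\<^bsub>Q\<^esub> Y = coset (x \<otimes>\<^bsub>A\<^esub> y)"
    using basis_carrier by (simp add: quotient_mult subset_iff)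
  also have "\<dots> = \<zero>\<^bsub>Q\<^esub>" using xy(1-3) ideal.a_subset by (simp add: orthogonal quotient_zero)
  finally show "X \<otimes>\<^bsub>Q\<^esub> Y = \<zero>\<^bsub>Q\<^esub>" .
qed

text \<open>
  The arcs of an associated graph are pairs of vertices, so the isomorphism acts on arcs by applying
  the coset map to both entries; source and range remain the two projections.
\<close>

lemma associated_graph_quotient_iso:
  "digraph_iso (quotient_graph (associated_graph K A B) S)
     (associated_graph K Q (coset ` (B - S)))"
proof -
  let ?G = "quotient_graph (associated_graph K A B) S"
  let ?B' = "coset ` (B - S)"
  let ?f = "\<lparr>iso_verts = coset, iso_arcs = map_prod coset coset, iso_head = snd, iso_tail = fst\<rparr>"
  have arcs: "arcs ?G = {(x, y). x \<in> B - S \<and> y \<in> B - S \<and> basis_coeff K A B (x \<otimes>\<^bsub>A\<^esub> x) y \<noteq> \<zero>\<^bsub>K\<^esub>}"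
    by (auto simp: quotient_graph_def associated_graph_def)
  have coeff: "basis_coeff K Q ?B' (coset x \<otimes>\<^bsub>Q\<^esub> coset x) (coset y) = basis_coeff K A B (x \<otimes>\<^bsub>A\<^esub> x) y"
    if "x \<in> B - S" "y \<in> B - S" for x y
    using that basis_carrier basis_coeff_coset[of "x \<otimes>\<^bsub>A\<^esub> x" y]
    by (auto simp: quotient_mult mult_closed)
  have "inj_on (map_prod coset coset) (arcs ?G)"
    using inj_on_coset unfolding arcs by (auto simp: inj_on_def)
  moreover have "wf_digraph ?G"
    by unfold_locales (auto simp: quotient_graph_def associated_graph_def)
  ultimately have "pre_digraph.digraph_isomorphism ?G ?f"
    unfolding pre_digraph.digraph_isomorphism_def
    using inj_on_coset by (auto simp: quotient_graph_def associated_graph_def)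
  moreover have "map_prod coset coset ` arcs ?G = arcs (associated_graph K Q ?B')"
  proof
    show "map_prod coset coset ` arcs ?G \<subseteq> arcs (associated_graph K Q ?B')"
      unfolding arcs using coeff by (auto simp: associated_graph_def)
    show "arcs (associated_graph K Q ?B') \<subseteq> map_prod coset coset ` arcs ?G"
    proof
      fix e assume "e \<in> arcs (associated_graph K Q ?B')"
      then obtain x y where xy: "x \<in> B - S" "y \<in> B - S" "e = (coset x, coset y)"
          "basis_coeff K Q ?B' (coset x \<otimes>\<^bsub>Q\<^esub> coset x) (coset y) \<noteq> \<zero>\<^bsub>K\<^esub>"
        by (auto simp: associated_graph_def)
      then have "(x, y) \<in> arcs ?G" unfolding arcs using coeff by auto
      then show "e \<in> map_prod coset coset ` arcs ?G" using xy(3) by (auto intro: rev_image_eqI)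
    qed
  qed
  then have "associated_graph K Q ?B' = app_iso ?f ?G"
    by (intro pre_digraph.equality) (auto simp: app_iso_def quotient_graph_def associated_graph_def)
  ultimately show ?thesis unfolding digraph_iso_def by blast
qed

end

theorem theorem6p5:
  fixes E :: "('v, 'e) pre_digraph" and H :: "'v set"
    and K :: "('k, 'n) ring_scheme" and A :: "('k, 'a, 'm) module_scheme"
    and B :: "'a set" and S :: "'a set"
  assumes "wf_digraph E" and "hereditary E H"
  shows
    "(H \<noteq> verts E \<longrightarrow> (maximal_hereditary E H \<longleftrightarrow> simple_graph (quotient_graph E H))) \<and>
     (simple_graph E \<longrightarrow>
        is_isolated_vertex E \<or> (\<forall>v. \<not> graph_source E v \<and> \<not> graph_sink E v)) \<and>
     (simple_graph E \<longrightarrow> strongly_connected_graph E) \<and>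
     (finite (verts E) \<and> verts E \<noteq> {} \<longrightarrow>
        (simple_graph E \<longleftrightarrow>
          (\<exists>u p. pre_digraph.awalk E u p u \<and> set (pre_digraph.awalk_verts E u p) = verts E))) \<and>
     (natural_basis K A B \<and> hereditary (associated_graph K A B) S \<longrightarrow>
        (\<exists>B'. natural_basis K (quotient_algebra A (module.span K A S)) B' \<and>
              digraph_iso (quotient_graph (associated_graph K A B) S)
                (associated_graph K (quotient_algebra A (module.span K A S)) B')))"
proof (intro conjI impI)
  interpret wf_digraph E by fact
  show "maximal_hereditary E H \<longleftrightarrow> simple_graph (quotient_graph E H)" if "H \<noteq> verts E"
    using assms(2) that by (rule maximal_hereditary_iff_simple_quotient)
  show "is_isolated_vertex E \<or> (\<forall>v. \<not> graph_source E v \<and> \<not> graph_sink E v)"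
    if "simple_graph E"
    using that by (rule simple_graph_isolated_or_no_source_sink)
  show "strongly_connected_graph E" if "simple_graph E"
    using simple_graph_imp_awalk[OF that] by (simp add: strongly_connected_graph_def)
  show "simple_graph E \<longleftrightarrow> (\<exists>u p. awalk u p u \<and> set (awalk_verts u p) = verts E)"
    if "finite (verts E) \<and> verts E \<noteq> {}"
    using that simple_graph_iff_closed_covering_awalk by blast
  show "\<exists>B'. natural_basis K (quotient_algebra A (module.span K A S)) B' \<and>
      digraph_iso (quotient_graph (associated_graph K A B) S)
        (associated_graph K (quotient_algebra A (module.span K A S)) B')"
    if "natural_basis K A B \<and> hereditary (associated_graph K A B) S"
  proof -
    interpret hereditary_quotient K A B S
      using that by (intro hereditary_quotient.intro hereditary_quotient_axioms.intro) auto
    show ?thesis using natural_basis_cosets associated_graph_quotient_iso by blast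
  qed
qed

end
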